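(* Let $p$ be a prime, let $\mathfrak{g}$ be a nonabelian finite simple Lie algebra over $\mathbf{F}_p$ and let $A$ be any generating set of $\mathfrak{g}$. Assume that $\ell(A^k)=p$ for some positive integer $k$. Then $$\operatorname{diam}(\mathfrak{g},A)\leq k\dim\mathfrak{g}+(\dim\mathfrak{g})^2.$$
   Context: $\mathbf{F}_p$ is the field with $p$ elements. A generating set of $\mathfrak{g}$ is a subset generating $\mathfrak{g}$ as a Lie algebra over $\mathbf{F}_p$; $\dim\mathfrak g$ is the dimension over $\mathbf{F}_p$. For subsets $X,Y\subseteq\mathfrak{g}$ write $X+Y=\{x+y \mid x\in X, y\in Y\}$ and $[X,Y]=\{[x,y]\mid x\in X,y\in Y\}$ (sets of elements, not spans). For $A\subseteq \mathfrak{g}$ set $A^1=\{0\}\cup A$ and, for $k\ge 2$, $A^k=\bigcup_{0<j<k}\left((A^j+A^{k-j})\cup[A^j,A^{k-j}]\right)$. The diameter $\operatorname{diam}(\mathfrak{g},A)$ is the least $k$ such that $A^k=\mathfrak{g}$. For $X\subseteq\mathfrak{g}$, $\ell(X)=\max\{|X\cap L| \mid L \text{ a one-dimensional } \mathbf{F}_p\text{-subspace of } \mathfrak{g}\}$. *)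

theory Defs
  imports
    "HOL-Computational_Algebra.Primes"
    "HOL-Library.Extended_Nat"
    "HOL-Library.Set_Algebras"
begin

locale lie_algebra = vector_space scale
  for scale :: "'f::field \<Rightarrow> 'g::ab_group_add \<Rightarrow> 'g" +
  fixes bracket :: "'g \<Rightarrow> 'g \<Rightarrow> 'g"
  assumes linear_bracket_left: "Vector_Spaces.linear scale scale (\<lambda>x. bracket x y)"
    and linear_bracket_right: "Vector_Spaces.linear scale scale (\<lambda>y. bracket x y)"
    and bracket_self: "bracket x x = 0"
    and jacobi: "bracket x (bracket y z) + bracket y (bracket z x) + bracket z (bracket x y) = 0"
begin

definition lie_subalgebra :: "'g set \<Rightarrow> bool" where
  "lie_subalgebra S \<longleftrightarrow> subspace S \<and> (\<forall>x\<in>S. \<forall>y\<in>S. bracket x y \<in> S)"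

definition lie_ideal :: "'g set \<Rightarrow> bool" where
  "lie_ideal I \<longleftrightarrow> subspace I \<and> (\<forall>x. \<forall>y\<in>I. bracket x y \<in> I)"

definition abelian :: bool where
  "abelian \<longleftrightarrow> (\<forall>x y. bracket x y = 0)"

text \<open>A one-dimensional algebra counts as simple here; it is excluded by \<open>\<not> abelian\<close>.\<close>

definition simple :: bool where
  "simple \<longleftrightarrow> (UNIV :: 'g set) \<noteq> {0} \<and> (\<forall>I. lie_ideal I \<longrightarrow> I = {0} \<or> I = UNIV)"

definition generating_set :: "'g set \<Rightarrow> bool" where
  "generating_set A \<longleftrightarrow> lie_subalgebra hull A = UNIV"

definition bracket_set :: "'g set \<Rightarrow> 'g set \<Rightarrow> 'g set" where
  "bracket_set X Y = {bracket x y | x y. x \<in> X \<and> y \<in> Y}"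

text \<open>
  \<open>set_power A k\<close> is the set \<open>A\<^sup>k\<close>, with \<open>+\<close> the elementwise sum of sets. It is meant for
  \<open>k \<ge> 1\<close> only; the value at \<open>0\<close> is a dummy, and the recursion never reaches it.
\<close>

function set_power :: "'g set \<Rightarrow> nat \<Rightarrow> 'g set" where
  "set_power A k =
    (if k = 0 then {}
     else if k = 1 then {0} \<union> A
     else (\<Union>j\<in>{0<..<k}. (set_power A j + set_power A (k - j))
                           \<union> bracket_set (set_power A j) (set_power A (k - j))))"
  by pat_completeness auto
termination
  by (relation "measure snd") auto

declare set_power.simps [simp del]

text \<open>
  The infimum in \<open>enat\<close> is the least such \<open>k\<close> if there is one, and \<open>\<infinity>\<close> otherwise. Hence
  a finite upper bound on the diameter includes the claim that some \<open>A\<^sup>k\<close> is everything.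
\<close>

definition diam :: "'g set \<Rightarrow> enat" where
  "diam A = (INF k\<in>{k. 0 < k \<and> set_power A k = UNIV}. enat k)"

text \<open>The maximum is meaningful for finite nonzero \<open>'g\<close>.\<close>

definition line_max :: "'g set \<Rightarrow> nat" where
  "line_max X = Max {card (X \<inter> L) | L. subspace L \<and> dim L = 1}"

end

end

(* If A^k contains a line, spanned by x say, then A^(k + m) contains the line through every iterated
   bracket of x with at most m elements of A. The span of these brackets grows strictly with m until
   it is stable under bracketing with A, hence an ideal, hence everything, which takes at most dim g
   steps. So g has a basis each of whose lines lies in A^(k + dim g); add up these dim g lines. *)
theory Submission
  imports Defs
begin

context lie_algebra
begin

section \<open>Bilinearity and antisymmetry of the bracket\<close>

lemmas bracket_add_left = linear_bracket_left[THEN Vector_Spaces.linear.axioms(3), THEN module_hom.add]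
lemmas bracket_add_right = linear_bracket_right[THEN Vector_Spaces.linear.axioms(3), THEN module_hom.add]
lemmas bracket_scale_left = linear_bracket_left[THEN Vector_Spaces.linear.axioms(3), THEN module_hom.scale]
lemmas bracket_scale_right = linear_bracket_right[THEN Vector_Spaces.linear.axioms(3), THEN module_hom.scale]
lemmas bracket_zero_left = linear_bracket_left[THEN Vector_Spaces.linear.axioms(3), THEN module_hom.zero]
lemmas bracket_zero_right = linear_bracket_right[THEN Vector_Spaces.linear.axioms(3), THEN module_hom.zero]

lemma bracket_minus: "bracket y x = - bracket x y"
proof -
  have "bracket (x + y) (x + y) = bracket x y + bracket y x"
    by (simp only: bracket_add_left bracket_add_right) (simp add: bracket_self)
  then have "bracket y x + bracket x y = 0"
    by (simp add: bracket_self add.commute)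
  then show ?thesis
    by (rule minus_unique[symmetric, OF trans[OF add.commute]])
qed

section \<open>Arithmetic of the powers of a subset\<close>

lemma set_power_one: "set_power A (Suc 0) = insert 0 A"
  by (subst set_power.simps) simp

lemma set_power_decomp:
  assumes "0 < i" "0 < j"
  shows "set_power A i + set_power A j \<union> bracket_set (set_power A i) (set_power A j)
    \<subseteq> set_power A (i + j)"
  \<comment> \<open>The fifth occurrence is the power on the right-hand side; its union is entered
    at the index \<open>i\<close>, whose complement in \<open>i + j\<close> is
    \<open>j\<close>.\<close>
  using assms by (subst (5) set_power.simps) (auto intro!: bexI[of _ i])

lemma set_power_add:
  assumes "0 < i" "0 < j" "x \<in> set_power A i" "y \<in> set_power A j"
  shows "x + y \<in> set_power A (i + j)"
  using set_power_decomp[OF assms(1,2)] assms(3,4) by (auto intro: set_plus_intro)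

lemma set_power_bracket:
  assumes "0 < i" "0 < j" "x \<in> set_power A i" "y \<in> set_power A j"
  shows "bracket x y \<in> set_power A (i + j)"
  using set_power_decomp[OF assms(1,2), of A] assms(3,4) unfolding bracket_set_def by blast

lemma set_power_mono:
  assumes "0 < i" "i \<le> j"
  shows "set_power A i \<subseteq> set_power A j"
  using assms(2)
proof (induction j rule: dec_induct)
  case (step j)
  have "x \<in> set_power A (Suc j)" if "x \<in> set_power A j" for x
    \<comment> \<open>Powers increase because \<open>0\<close> belongs to the first power: write
      \<open>x\<close> as \<open>x + 0\<close>.\<close>
    using set_power_add[of j "Suc 0" x A 0] that step assms(1)
      by (simp add: set_power_one)
  with step.IH show ?case by blast
qed simp

text \<open>Exponents add with each summand. An empty sum would land in the dummy power at
  \<open>0\<close>, which is empty; hence \<open>B \<noteq> {}\<close>.\<close>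

lemma sum_mem_set_power:
  assumes "finite B" "B \<noteq> {}" "0 < m" "\<And>b. b \<in> B \<Longrightarrow> f b \<in> set_power A m"
  shows "sum f B \<in> set_power A (card B * m)"
  using assms(1,2,4)
proof (induction B rule: finite_ne_induct)
  case (insert b B)
  then have "f b + sum f B \<in> set_power A (m + card B * m)"
    using \<open>0 < m\<close> by (intro set_power_add) (auto simp: card_gt_0_iff)
  with insert show ?case by simp
qed simp

section \<open>Stabilizers of subspaces, and ideals\<close>

lemma bracket_mem_span:
  assumes "\<And>y. y \<in> S \<Longrightarrow> bracket a y \<in> span S" "y \<in> span S"
  shows "bracket a y \<in> span S"
  using assms(2)
proof (induction rule: span_induct)
  case (step y)
  then show ?case using assms(1) by blast
next
  case base
  show ?case unfolding mem_Collect_eq subspace_def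
    by (auto simp: bracket_zero_right bracket_add_right bracket_scale_right
        intro: span_zero span_add span_scale)
qed

text \<open>By the Jacobi identity, \<open>bracket a b\<close> acts as the commutator of the actions
  of \<open>a\<close> and \<open>b\<close>, so it preserves every subspace that both
  preserve.\<close>

lemma subalgebra_stabilizer:
  assumes "subspace V"
  shows "lie_subalgebra {a. \<forall>y\<in>V. bracket a y \<in> V}"
proof -
  have "bracket (bracket a b) y \<in> V"
    if a: "\<forall>y\<in>V. bracket a y \<in> V" and b: "\<forall>y\<in>V. bracket b y \<in> V" and y: "y \<in> V" for a b y
  proof -
    have "bracket (bracket a b) y = bracket a (bracket b y) - bracket b (bracket a y)"
      using jacobi[of a b y] bracket_minus[of y "bracket a b"]
        bracket_minus[of y a] module_hom.neg[OF Vector_Spaces.linear.axioms(3)[OF linear_bracket_right], of b "bracket a y"]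
      by (simp add: algebra_simps)
    with a b y show ?thesis using assms by (simp add: subspace_diff)
  qed
  then show ?thesis
    using assms unfolding lie_subalgebra_def subspace_def
    by (auto simp: bracket_zero_left bracket_add_left bracket_scale_left)
qed

text \<open>The stabilizer of \<open>span S\<close> is a subalgebra containing \<open>A\<close>,
  hence everything. So stability only has to be tested on generators and on a spanning set.\<close>

lemma generating_set_imp_ideal:
  assumes "generating_set A" "\<And>a y. a \<in> A \<Longrightarrow> y \<in> S \<Longrightarrow> bracket a y \<in> span S"
  shows "lie_ideal (span S)"
proof -
  let ?N = "{a. \<forall>y\<in>span S. bracket a y \<in> span S}"
  have "A \<subseteq> ?N" using assms(2) by (auto intro: bracket_mem_span)
  then have "lie_subalgebra hull A \<subseteq> ?N"
    by (intro hull_minimal subalgebra_stabilizer) auto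
  then show ?thesis
    using assms(1) by (auto simp: lie_ideal_def generating_set_def)
qed

section \<open>Iterated brackets with elements of \<open>A\<close>\<close>

primrec iter_bracket :: "'g set \<Rightarrow> 'g \<Rightarrow> nat \<Rightarrow> 'g set" where
  "iter_bracket A x 0 = {x}"
| "iter_bracket A x (Suc m) = iter_bracket A x m \<union> bracket_set A (iter_bracket A x m)"

lemma start_in_iter_bracket: "x \<in> iter_bracket A x m"
  by (induction m) auto

text \<open>A scalar in front of a nested bracket can be moved inward until it meets
  \<open>x\<close>, whose whole line is available; each bracketing with \<open>A\<close> costs one
  in the exponent. Only single brackets are collected, not their span, since sums would cost
  more.\<close>

lemma scale_iter_bracket_mem_set_power:
  assumes "0 < k" "\<And>c. scale c x \<in> set_power A k" "y \<in> iter_bracket A x m"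
  shows "scale c y \<in> set_power A (k + m)"
  using assms(3)
proof (induction m arbitrary: c y)
  case 0
  then show ?case using assms(2) by simp
next
  case (Suc m)
  show ?case
  proof (cases "y \<in> iter_bracket A x m")
    case True
    then show ?thesis
      using Suc.IH set_power_mono[of "k + m" "k + Suc m" A] \<open>0 < k\<close> by auto
  next
    case False
    then obtain a z where y: "y = bracket a z" "a \<in> A" "z \<in> iter_bracket A x m"
      using Suc.prems by (auto simp: bracket_set_def)
    then have "bracket a (scale c z) \<in> set_power A (1 + (k + m))"
      using Suc.IH \<open>0 < k\<close> by (intro set_power_bracket) (auto simp: set_power_one)
    then show ?thesis by (simp add: y bracket_scale_right)
  qed
qed

text \<open>A span that contains \<open>x\<close>, is proper and is stable under \<open>A\<close>
  would contradict simplicity. So as long as the span is proper, the next stage provides a vector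
  outside it.\<close>

lemma span_iter_bracket_grows:
  assumes "simple" "generating_set A" "x \<noteq> 0"
  shows "span (iter_bracket A x m) = UNIV \<or>
    (\<exists>B. independent B \<and> B \<subseteq> iter_bracket A x m \<and> finite B \<and> card B = Suc m)"
proof (induction m)
  case 0
  show ?case
    using assms(3) by (intro disjI2 exI[of _ "{x}"]) simp
next
  case (Suc m)
  let ?S = "iter_bracket A x m"
  have mono: "?S \<subseteq> iter_bracket A x (Suc m)" by simp
  show ?case
  proof (cases "span ?S = UNIV")
    case True
    then show ?thesis using span_mono[OF mono] by blast
  next
    case False
    then obtain B where B: "independent B" "B \<subseteq> ?S" "finite B" "card B = Suc m"
      using Suc.IH by blast
    have "span ?S \<noteq> {0}"
      using span_base[OF start_in_iter_bracket] assms(3) by blast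
    with False assms(1) have "\<not> lie_ideal (span ?S)"
      unfolding simple_def by blast
    then obtain a y where ay: "a \<in> A" "y \<in> ?S" "bracket a y \<notin> span ?S"
      using generating_set_imp_ideal[OF assms(2)] by blast
    let ?z = "bracket a y"
    \<comment> \<open>\<open>B\<close> need not span \<open>?S\<close>, but lying outside the larger
      span is enough to extend \<open>B\<close>.\<close>
    have "?z \<notin> span B" using ay(3) span_mono[OF B(2)] by blast
    then have "independent (insert ?z B)" "?z \<notin> B"
      using B(1) by (auto simp: independent_insert intro: span_base)
    moreover have "?z \<in> iter_bracket A x (Suc m)"
      using ay by (auto simp: bracket_set_def)
    ultimately show ?thesis
      using B mono by (intro disjI2 exI[of _ "insert ?z B"]) auto
  qed
qed

lemma span_iter_bracket_dim:
  assumes "simple" "generating_set A" "x \<noteq> 0" "finite (UNIV :: 'g set)"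
  shows "span (iter_bracket A x (dim (UNIV :: 'g set))) = UNIV"
proof (rule ccontr)
  assume "span (iter_bracket A x (dim (UNIV :: 'g set))) \<noteq> UNIV"
  \<comment> \<open>The count starts at one for \<open>m = 0\<close>, so at the dimension there is
    already one independent vector too many.\<close>
  then obtain B where B: "independent B" "card B = Suc (dim (UNIV :: 'g set))"
    using span_iter_bracket_grows[OF assms(1-3)] by blast
  obtain C where C: "UNIV \<subseteq> span C" "card C = dim (UNIV :: 'g set)"
    by (rule basis_exists[of UNIV])
  have "finite C" using assms(4) by (rule rev_finite_subset) simp
  then have "card B \<le> card C"
    using independent_span_bound[of C B] B(1) C(1) by blast
  with B C show False by simp
qed

section \<open>Full lines and the diameter bound\<close>

lemma card_line:
  assumes "x \<noteq> 0"
  shows "card (range (\<lambda>c. scale c x)) = card (UNIV :: 'f set)"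
  using assms by (intro card_image) (auto simp: inj_on_def)

lemma line_generator:
  assumes "subspace L" "dim L = 1"
  obtains x where "x \<noteq> 0" "L = range (\<lambda>c. scale c x)"
proof -
  obtain B where B: "B \<subseteq> L" "independent B" "L \<subseteq> span B" "card B = dim L"
    by (rule basis_exists[of L])
  then obtain x where x: "B = {x}" using assms(2) by (auto simp: card_1_singleton_iff)
  have "L = span B" using B span_minimal[OF B(1) assms(1)] by blast
  with x B(2) show ?thesis by (intro that[of x]) (auto simp: span_singleton)
qed

text \<open>The maximum is attained on some line; a line has exactly as many elements as the field,
  so the intersection with \<open>X\<close> is the entire line.\<close>

lemma line_max_full:
  assumes "simple" "finite (UNIV :: 'g set)" "line_max X = card (UNIV :: 'f set)"
  obtains x where "x \<noteq> 0" "\<And>c. scale c x \<in> X"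
proof -
  \<comment> \<open>A nonzero vector shows that lines exist, so that \<open>Max\<close> is taken
    over a nonempty set.\<close>
  obtain z :: 'g where "z \<noteq> 0" using assms(1) by (auto simp: simple_def)
  then have z: "dim (span {z}) = 1"
    by (intro dim_unique[of "{z}"]) (auto simp: span_base)
  let ?M = "{card (X \<inter> L) | L. subspace L \<and> dim L = 1}"
  have "?M \<noteq> {}" using z by (auto intro: subspace_span)
  moreover have "finite ?M"
  proof -
    have "finite (UNIV :: 'g set set)" using assms(2) by (simp add: Finite_Set.finite_set)
    then have "finite {L :: 'g set. subspace L \<and> dim L = 1}" by (rule rev_finite_subset) simp
    then show ?thesis by (rule finite_image_set)
  qed
  ultimately have "line_max X \<in> ?M" unfolding line_max_def by (rule Max_in[rotated])
  then obtain L where L: "subspace L" "dim L = 1" "card (X \<inter> L) = card (UNIV :: 'f set)"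
    using assms(3) by auto
  then obtain x where x: "x \<noteq> 0" "L = range (\<lambda>c. scale c x)"
    by (metis line_generator)
  have "finite L" using assms(2) by (rule rev_finite_subset) simp
  then have "X \<inter> L = L" using L(3) x card_line[OF x(1)] by (intro card_subset_eq) auto
  with x show ?thesis by (intro that[of x]) auto
qed

lemma set_power_eq_UNIV:
  assumes "simple" "generating_set A" "finite (UNIV :: 'g set)" "0 < k"
    and "x \<noteq> 0" "\<And>c. scale c x \<in> set_power A k"
  defines "n \<equiv> dim (UNIV :: 'g set)"
  shows "0 < n" and "set_power A (n * (k + n)) = UNIV"
proof -
  let ?S = "iter_bracket A x n"
  \<comment> \<open>The basis is chosen among the brackets themselves, so that each of its lines
    lies in the power \<open>k + n\<close>.\<close>
  obtain B where B: "B \<subseteq> ?S" "independent B" "?S \<subseteq> span B" "card B = dim ?S"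
    by (rule basis_exists[of ?S])
  have "span ?S = UNIV" unfolding n_def by (rule span_iter_bracket_dim) (fact assms)+
  then have sB: "span B = UNIV" using span_minimal[OF B(3) subspace_span] by blast
  then have cB: "card B = n" unfolding n_def using B(2) by (intro dim_unique[symmetric]) auto
  have fin: "finite B" using assms(3) by (rule rev_finite_subset) simp
  \<comment> \<open>The empty set spans only \<open>0\<close>, and \<open>x\<close> is
    nonzero.\<close>
  have ne: "B \<noteq> {}" using sB assms(5) by auto
  then show "0 < n" using cB fin by (auto simp: card_gt_0_iff)
  have "v \<in> set_power A (n * (k + n))" for v
  proof -
    have "v \<in> span B" using sB by simp
    then obtain u where v: "v = (\<Sum>b\<in>B. scale (u b) b)"
      using span_finite[OF fin] by auto
    have "scale (u b) b \<in> set_power A (k + n)" if "b \<in> B" for b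
      using that B(1) assms(4,6) by (intro scale_iter_bracket_mem_set_power[of k x]) auto
    then show ?thesis
      unfolding v cB[symmetric] using fin ne assms(4) by (intro sum_mem_set_power) auto
  qed
  then show "set_power A (n * (k + n)) = UNIV" by blast
qed

end

theorem proposition1p5:
  fixes p k :: nat
    and scale :: "'f::field \<Rightarrow> 'g::ab_group_add \<Rightarrow> 'g"
    and bracket :: "'g \<Rightarrow> 'g \<Rightarrow> 'g"
    and A :: "'g set"
  assumes "prime p"
    and "card (UNIV :: 'f set) = p"
    and "lie_algebra scale bracket"
    and "finite (UNIV :: 'g set)"
    and "lie_algebra.simple scale bracket"
    and "\<not> lie_algebra.abelian bracket"
    and "lie_algebra.generating_set scale bracket A"
    and "k > 0"
    and "lie_algebra.line_max scale (lie_algebra.set_power bracket A k) = p"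
  shows "lie_algebra.diam bracket A
    \<le> enat (k * vector_space.dim scale (UNIV :: 'g set)
              + (vector_space.dim scale (UNIV :: 'g set))\<^sup>2)"
proof -
  interpret lie_algebra scale bracket by (rule assms(3))
  let ?n = "dim (UNIV :: 'g set)"
  obtain x where x: "x \<noteq> 0" "\<And>c. scale c x \<in> set_power A k"
    using assms(2,4,5,9) by (metis line_max_full)
  note full = set_power_eq_UNIV[OF assms(5,7,4,8) x]
  \<comment> \<open>The exponent \<open>?n * (k + ?n)\<close> is a candidate in the infimum only if
    it is positive, which is why \<open>0 < n\<close> was recorded along with the equality.\<close>
  have "diam A \<le> enat (?n * (k + ?n))"
    unfolding diam_def using full \<open>k > 0\<close> by (intro INF_lower) auto
  then show ?thesis by (simp add: algebra_simps power2_eq_square)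
qed

end
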